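(* Let $A_1,A_2$ be real $2\times2$ matrices with $A_i=P_iJ_iP_i^{-1}$, $P_i$ real invertible, $J_1=\mathrm{diag}(-p_1,-q_1)$ with $0<p_1<q_1$, $J_2=\begin{pmatrix}-\alpha_2&\beta_2\\-\beta_2&-\alpha_2\end{pmatrix}$ with $\alpha_2>0$, $\beta_2\ne0$, where $P_1,P_2$ are chosen so that $M=P_2^{-1}P_1=\begin{pmatrix}a&b\\c&d\end{pmatrix}$ has $\det M=1$. Let $\tau_{1,2}$ be the unique fixed point in $[0,\infty)$ of $$S(t)=-\left(\frac{q_1+p_1}{2\alpha_2}\right)t+\frac{1}{\alpha_2}\sinh^{-1}\left(|ab+cd|\cosh\left(\tfrac{q_1-p_1}{2}t\right)+\sinh\left(\tfrac{q_1-p_1}{2}t\right)\right).$$ Then (such a unique fixed point exists and) the switched system $\dot x(t)=A_{\sigma(t)}x(t)$ is asymptotically stable for all signals $\sigma\in S_{\tau_{1,2}}$.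
   Context: A signal is a right-continuous piecewise constant $\sigma:[0,\infty)\to\{1,2\}$ with $\sigma(0)=1$ and infinitely many discontinuities $0=d_0<d_1<d_2<\cdots$, $d_k\to\infty$. For $j\ge1$, $t_j=d_{2j-1}-d_{2j-2}>0$ and $s_j=d_{2j}-d_{2j-1}>0$ are the successive times spent in subsystems $A_1$ and $A_2$. For fixed $\sigma$ the system $\dot x(t)=A_{\sigma(t)}x(t)$ on $\mathbb R^2$ is stable if for every $\epsilon>0$ there is $\delta>0$ such that $\|x(0)\|<\delta$ implies $\|x(t)\|<\epsilon$ for all $t>0$; it is asymptotically stable if it is stable and $\|x(t)\|\to0$ as $t\to\infty$ for every $x(0)$. For $\tau\ge 0$, $S_\tau$ is the set of signals with $t_j\ge\tau$ and $s_j\ge\tau$ for all $j\in\mathbb N$. *)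

theory Defs
  imports "HOL-Analysis.Analysis"
begin

definition discontinuities :: "(real \<Rightarrow> nat) \<Rightarrow> real set" where
  "discontinuities \<sigma> = {t. 0 < t \<and> \<not> isCont \<sigma> t}"

text \<open>
  The sequence \<open>d\<close> starts with the convention \<open>d 0 = 0\<close>; the points of discontinuity proper are
  \<open>d 1, d 2, \<dots>\<close>. A signal determines \<open>d\<close> uniquely. Values of \<open>\<sigma>\<close> at negative times are irrelevant.
\<close>

definition switching_times :: "(real \<Rightarrow> nat) \<Rightarrow> (nat \<Rightarrow> real) \<Rightarrow> bool" where
  "switching_times \<sigma> d \<longleftrightarrow>
     d 0 = 0 \<and> strict_mono d \<and> filterlim d at_top sequentially \<and>
     discontinuities \<sigma> = d ` {1..} \<and>
     (\<forall>k. \<sigma> constant_on {d k<..<d (Suc k)})"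

definition signal :: "(real \<Rightarrow> nat) \<Rightarrow> bool" where
  "signal \<sigma> \<longleftrightarrow>
     (\<forall>t\<ge>0. \<sigma> t \<in> {1, 2}) \<and> \<sigma> 0 = 1 \<and>
     (\<forall>t\<ge>0. continuous (at_right t) \<sigma>) \<and>
     (\<exists>d. switching_times \<sigma> d)"

definition dwell_1 :: "(nat \<Rightarrow> real) \<Rightarrow> nat \<Rightarrow> real" where
  "dwell_1 d j = d (2 * j - 1) - d (2 * j - 2)"

definition dwell_2 :: "(nat \<Rightarrow> real) \<Rightarrow> nat \<Rightarrow> real" where
  "dwell_2 d j = d (2 * j) - d (2 * j - 1)"

definition dwell_signals :: "real \<Rightarrow> (real \<Rightarrow> nat) set" where
  "dwell_signals \<tau> =
     {\<sigma>. signal \<sigma> \<and>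
         (\<exists>d. switching_times \<sigma> d \<and> (\<forall>j\<ge>1. dwell_1 d j \<ge> \<tau> \<and> dwell_2 d j \<ge> \<tau>))}"

text \<open>
  Trajectories are continuous on \<open>[0,\<infinity>)\<close> and satisfy the differential equation at every time at
  which the signal does not switch (one-sidedly at time 0).
\<close>

definition switched_solution ::
    "(nat \<Rightarrow> real^2^2) \<Rightarrow> (real \<Rightarrow> nat) \<Rightarrow> (real \<Rightarrow> real^2) \<Rightarrow> bool" where
  "switched_solution A \<sigma> x \<longleftrightarrow>
     continuous_on {0..} x \<and>
     (\<forall>t\<ge>0. t \<notin> discontinuities \<sigma> \<longrightarrow>
        (x has_vector_derivative A (\<sigma> t) *v x t) (at t within {0..}))"

definition switched_stable :: "(nat \<Rightarrow> real^2^2) \<Rightarrow> (real \<Rightarrow> nat) \<Rightarrow> bool" where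
  "switched_stable A \<sigma> \<longleftrightarrow>
     (\<forall>\<epsilon>>0. \<exists>\<delta>>0. \<forall>x. switched_solution A \<sigma> x \<longrightarrow> norm (x 0) < \<delta> \<longrightarrow>
        (\<forall>t>0. norm (x t) < \<epsilon>))"

definition switched_asymptotically_stable :: "(nat \<Rightarrow> real^2^2) \<Rightarrow> (real \<Rightarrow> nat) \<Rightarrow> bool" where
  "switched_asymptotically_stable A \<sigma> \<longleftrightarrow>
     switched_stable A \<sigma> \<and>
     (\<forall>x. switched_solution A \<sigma> x \<longrightarrow> ((\<lambda>t. norm (x t)) \<longlongrightarrow> 0) at_top)"

definition mat2 :: "real \<Rightarrow> real \<Rightarrow> real \<Rightarrow> real \<Rightarrow> real^2^2" where
  "mat2 a b c d = vector [vector [a, b], vector [c, d]]"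

end

theory Submission imports Defs begin

text \<open>
  Measure trajectories by the Euclidean norm of \<open>y = P\<^sub>2\<inverse> x\<close>. In these coordinates the focus \<open>A\<^sub>2\<close> is
  a rotation damped by \<open>exp (- \<alpha> s)\<close>, while the flow of the node \<open>A\<^sub>1\<close> is \<open>exp (- (p + q) t / 2)\<close> times a
  matrix of determinant 1 whose norm \<open>\<mu>\<close> satisfies \<open>\<mu> - 1 / \<mu> = 2 sqrt (1 + m\<^sup>2) sinh (k t)\<close> with
  \<open>m = |a b + c d|\<close> and \<open>k = (q - p) / 2\<close>. Since \<open>sqrt (1 + m\<^sup>2) sinh \<le> m cosh + sinh\<close>, the log-norm of the
  node flow is at most \<open>\<alpha> S t\<close>. The function \<open>\<alpha> S\<close> decreases at rate at least \<open>p\<close>, so beyond the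
  fixed point of \<open>S\<close> every cycle is contracting. The inequality is strict when \<open>m > 0\<close>, and
  \<open>\<tau> = 0\<close> when \<open>m = 0\<close>; in both cases the contraction is exponential in the length of the cycle,
  uniformly over all cycles.
\<close>

section \<open>Operator norm of a real 2x2 matrix of determinant 1\<close>

lemma psd_2x2:
  fixes A B C u v :: real
  assumes "A + C \<ge> 0" and "B\<^sup>2 \<le> A * C"
  shows "0 \<le> A * u\<^sup>2 + 2 * B * u * v + C * v\<^sup>2"
proof -
  have "0 \<le> A * C"
    using assms(2) zero_le_power2[of B] by linarith
  with assms(1) have "0 \<le> A" "0 \<le> C"
    by (auto simp: zero_le_mult_iff)
  show ?thesis
  proof (cases "A = 0")
    case True
    with assms(2) have "B = 0" by simp
    with True \<open>0 \<le> C\<close> show ?thesis by simp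
  next
    case False
    have "A * (A * u\<^sup>2 + 2 * B * u * v + C * v\<^sup>2) = (A * u + B * v)\<^sup>2 + (A * C - B\<^sup>2) * v\<^sup>2"
      by (simp add: power2_eq_square algebra_simps)
    also have "\<dots> \<ge> 0" using assms(2) by simp
    finally show ?thesis
      using False \<open>0 \<le> A\<close> by (simp add: zero_le_mult_iff)
  qed
qed

text \<open>The two conditions make \<open>s\<close> and \<open>1 / s\<close> the singular values.
  Instead of computing them, the proof checks that \<open>s\<^sup>2 * I - N^T N\<close> is positive
  semidefinite, where \<open>N\<close> has rows (w, x) and (y, z): its trace is nonnegative and its
  determinant is 0.\<close>

lemma norm_bound_det_1:
  fixes w x y z s u v :: real
  assumes det: "w * z - x * y = 1" and frob: "w\<^sup>2 + x\<^sup>2 + y\<^sup>2 + z\<^sup>2 = s\<^sup>2 + 1 / s\<^sup>2" and s: "s \<ge> 1"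
  shows "(w * u + x * v)\<^sup>2 + (y * u + z * v)\<^sup>2 \<le> s\<^sup>2 * (u\<^sup>2 + v\<^sup>2)"
proof -
  define A B C where "A = s\<^sup>2 - w\<^sup>2 - y\<^sup>2" and "B = - (w * x + y * z)" and "C = s\<^sup>2 - x\<^sup>2 - z\<^sup>2"
  have s2: "s\<^sup>2 \<ge> 1" using s by simp
  have "A + C = s\<^sup>2 - 1 / s\<^sup>2"
    using frob by (simp add: A_def C_def)
  also have "\<dots> \<ge> 0" using s2 divide_le_eq_1_pos[of "s\<^sup>2" 1] by linarith
  finally have tr: "A + C \<ge> 0" .
  have "A * C - B\<^sup>2 = s\<^sup>2 * (s\<^sup>2 - (w\<^sup>2 + x\<^sup>2 + y\<^sup>2 + z\<^sup>2)) + (w * z - x * y)\<^sup>2"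
    by (simp add: A_def B_def C_def power2_eq_square algebra_simps)
  also have "\<dots> = 0" unfolding frob det using s by (simp add: algebra_simps)
  finally have "B\<^sup>2 \<le> A * C" by simp
  from psd_2x2[OF tr this, of u v] show ?thesis
    by (simp add: A_def B_def C_def power2_eq_square algebra_simps)
qed

text \<open>With \<open>M\<close> of rows (a, b) and (c, d), the map in question is
  \<open>N = M diag(e^x, e^(-x)) M^(-1)\<close>, of determinant 1. Its squared Frobenius norm is
  \<open>4 * (1 + m\<^sup>2) * (sinh x)\<^sup>2 + 2\<close> for \<open>m = a * b + c * d\<close>;
  equating this with \<open>(2 * sinh g)\<^sup>2 + 2\<close>, the value for singular values
  \<open>exp g\<close> and \<open>exp (- g)\<close>, gives the formula for \<open>g\<close>.\<close>

lemma node_flow_bound: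
  fixes a b c d x z1 z2 :: real
  assumes det: "a * d - b * c = 1" and x: "x \<ge> 0"
  defines "g \<equiv> arsinh (sqrt (1 + (a * b + c * d)\<^sup>2) * sinh x)"
  shows "(a * exp x * z1 + b * exp (- x) * z2)\<^sup>2 + (c * exp x * z1 + d * exp (- x) * z2)\<^sup>2
          \<le> (exp g)\<^sup>2 * ((a * z1 + b * z2)\<^sup>2 + (c * z1 + d * z2)\<^sup>2)"
proof -
  define E F where "E = exp x" and "F = exp (- x)"
  have EF: "E * F = 1" by (simp add: E_def F_def flip: exp_add)
  have ad: "a * d = 1 + b * c" using det by simp
  define u v where "u = a * z1 + b * z2" and "v = c * z1 + d * z2"
  have z1: "z1 = d * u - b * v"
  proof -
    have "d * u - b * v = (a * d - b * c) * z1" by (simp add: u_def v_def algebra_simps)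
    then show ?thesis by (simp add: det)
  qed
  have z2: "z2 = a * v - c * u"
  proof -
    have "a * v - c * u = (a * d - b * c) * z2" by (simp add: u_def v_def algebra_simps)
    then show ?thesis by (simp add: det)
  qed
  \<comment> \<open>These are the entries of \<open>N\<close>, which acts on
    \<open>(u, v) = M (z1, z2)\<close>.\<close>
  define w x' y z where "w = a * d * E - b * c * F" and "x' = a * b * (F - E)"
    and "y = c * d * (E - F)" and "z = a * d * F - b * c * E"
  have "w * z - x' * y = E * F * (a * d - b * c)\<^sup>2"
    by (simp add: w_def x'_def y_def z_def power2_eq_square algebra_simps)
  then have det1: "w * z - x' * y = 1" by (simp add: EF det)
  have g: "2 * sinh g = sqrt (1 + (a * b + c * d)\<^sup>2) * (E - F)"
  proof -
    have "2 * sinh x = E - F" by (simp add: sinh_def E_def F_def)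
    then show ?thesis unfolding g_def sinh_arsinh_real by (metis mult.left_commute)
  qed
  have "0 \<le> sqrt (1 + (a * b + c * d)\<^sup>2) * sinh x" using x by simp
  then have "g \<ge> 0" unfolding g_def
    by (metis arsinh_real_neg_iff not_less)
  then have s: "exp g \<ge> 1" by simp
  have "(exp g)\<^sup>2 + 1 / (exp g)\<^sup>2 = (2 * sinh g)\<^sup>2 + 2"
    by (simp add: sinh_def power2_eq_square algebra_simps exp_minus divide_simps)
  also have "\<dots> = (1 + (a * b + c * d)\<^sup>2) * (E - F)\<^sup>2 + 2 * (E * F)"
    by (simp add: g power_mult_distrib EF)
  also have "\<dots> = w\<^sup>2 + x'\<^sup>2 + y\<^sup>2 + z\<^sup>2"
  proof -
    \<comment> \<open>Written as a difference, this is a polynomial identity for every matrix; the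
      determinant enters only through the factor \<open>det^2 - 1\<close>.\<close>
    have "w\<^sup>2 + x'\<^sup>2 + y\<^sup>2 + z\<^sup>2 - ((1 + (a * b + c * d)\<^sup>2) * (E - F)\<^sup>2 + 2 * (E * F))
       = (a*d - b*c - 1) * (a*d - b*c + 1) * (E\<^sup>2 + F\<^sup>2)"
      by (simp add: w_def x'_def y_def z_def power2_eq_square algebra_simps)
    then show ?thesis by (simp add: det)
  qed
  finally have "w\<^sup>2 + x'\<^sup>2 + y\<^sup>2 + z\<^sup>2 = (exp g)\<^sup>2 + 1 / (exp g)\<^sup>2" by simp
  from norm_bound_det_1[OF det1 this s, of u v]
  have "(w * u + x' * v)\<^sup>2 + (y * u + z * v)\<^sup>2 \<le> (exp g)\<^sup>2 * (u\<^sup>2 + v\<^sup>2)" .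
  moreover have "w * u + x' * v = a * E * z1 + b * F * z2" "y * u + z * v = c * E * z1 + d * F * z2"
    by (simp_all add: z1 z2 w_def x'_def y_def z_def algebra_simps)
  ultimately show ?thesis by (simp add: E_def F_def u_def v_def)
qed

section \<open>The log-norm, its upper bound and the fixed point\<close>

text \<open>
  \<open>log_bound\<close> is \<open>\<alpha> S\<close>, and \<open>log_norm\<close> is the exact log-norm of the node flow in the coordinates \<open>y\<close>.
\<close>

definition log_bound :: "real \<Rightarrow> real \<Rightarrow> real \<Rightarrow> real \<Rightarrow> real" where
  "log_bound m p q t =
     - ((q + p) / 2) * t + arsinh (m * cosh ((q - p) / 2 * t) + sinh ((q - p) / 2 * t))"

definition log_norm :: "real \<Rightarrow> real \<Rightarrow> real \<Rightarrow> real \<Rightarrow> real" where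
  "log_norm m p q t = - ((q + p) / 2) * t + arsinh (sqrt (1 + m\<^sup>2) * sinh ((q - p) / 2 * t))"

lemma arsinh_le_iff_real: "arsinh x \<le> arsinh y \<longleftrightarrow> x \<le> (y::real)"
  by (meson arsinh_less_iff_real not_less)

text \<open>
  With \<open>m cosh x + sinh x = sinh G\<close> one has \<open>cosh x + m sinh x \<le> cosh G\<close>, and the addition theorem
  for \<open>sinh\<close> gives the Lipschitz bound without differentiation.
\<close>

lemma arsinh_growth:
  fixes m x y :: real
  assumes "m \<ge> 0" "0 \<le> x" "x \<le> y"
  shows "arsinh (m * cosh y + sinh y) \<le> arsinh (m * cosh x + sinh x) + (y - x)"
proof -
  define G where "G = arsinh (m * cosh x + sinh x)"
  define \<delta> where "\<delta> = y - x"
  have y: "y = x + \<delta>" and \<delta>: "\<delta> \<ge> 0" using assms by (auto simp: \<delta>_def)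
  have sG: "sinh G = m * cosh x + sinh x" by (simp add: G_def)
  have "cosh x + m * sinh x \<le> cosh G"
  proof (rule power2_le_imp_le)
    have "(cosh G)\<^sup>2 - (cosh x + m * sinh x)\<^sup>2 = 1 + sinh x ^ 2 - cosh x ^ 2 + m\<^sup>2 * (cosh x ^ 2 - sinh x ^ 2)"
      by (simp add: cosh_square_eq[of G] sG) (simp add: power2_eq_square algebra_simps)
    also have "\<dots> = m\<^sup>2" by (simp add: cosh_square_eq)
    finally show "(cosh x + m * sinh x)\<^sup>2 \<le> (cosh G)\<^sup>2"
      using zero_le_power2[of m] by linarith
  qed simp
  then have "(cosh x + m * sinh x) * sinh \<delta> \<le> cosh G * sinh \<delta>"
    using \<delta> by (intro mult_right_mono) auto
  moreover have "m * cosh y + sinh y = sinh G * cosh \<delta> + (cosh x + m * sinh x) * sinh \<delta>"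
    by (simp add: y sinh_add cosh_add sG algebra_simps)
  ultimately have "m * cosh y + sinh y \<le> sinh (G + \<delta>)"
    by (simp add: sinh_add)
  then have "arsinh (m * cosh y + sinh y) \<le> arsinh (sinh (G + \<delta>))"
    by (simp only: arsinh_le_iff_real)
  then show ?thesis by (simp add: arsinh_sinh_real G_def \<delta>_def)
qed

text \<open>By \<open>arsinh_growth\<close> the arsinh term grows at rate at most
  \<open>(q - p) / 2\<close>, while the linear term falls at rate \<open>(q + p) / 2\<close>; the
  net rate is at most \<open>- p\<close>.\<close>

lemma log_bound_decrease:
  assumes "m \<ge> 0" "p < q" "0 \<le> s" "s \<le> t"
  shows "log_bound m p q t \<le> log_bound m p q s - p * (t - s)"
proof -
  have k: "(q - p) / 2 \<ge> 0" using assms by simp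
  have "(q - p) / 2 * s \<le> (q - p) / 2 * t" "0 \<le> (q - p) / 2 * s"
    using k assms by (auto intro: mult_left_mono simp del: times_divide_eq_left)
  from arsinh_growth[OF assms(1) this(2,1)]
  show ?thesis unfolding log_bound_def by (simp add: field_simps)
qed

text \<open>The squares of the two sides differ by
  \<open>2 * m * sinh x * cosh x + m\<^sup>2\<close>. The summand \<open>m\<^sup>2\<close> keeps the
  second inequality strict even at \<open>x = 0\<close>.\<close>

lemma sqrt_mult_sinh_bound:
  fixes m x :: real
  assumes "m \<ge> 0" "x \<ge> 0"
  shows "sqrt (1 + m\<^sup>2) * sinh x \<le> m * cosh x + sinh x"
    and "m > 0 \<Longrightarrow> sqrt (1 + m\<^sup>2) * sinh x < m * cosh x + sinh x"
proof -
  have nn: "0 \<le> m * cosh x + sinh x" using assms by simp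
  have eq: "(m * cosh x + sinh x)\<^sup>2 - (sqrt (1 + m\<^sup>2) * sinh x)\<^sup>2 = 2 * m * sinh x * cosh x + m\<^sup>2"
    by (simp add: power_mult_distrib power2_sum cosh_square_eq algebra_simps)
  have ge: "0 \<le> 2 * m * sinh x * cosh x" using assms by simp
  show "sqrt (1 + m\<^sup>2) * sinh x \<le> m * cosh x + sinh x"
    using eq ge zero_le_power2[of m] by (intro power2_le_imp_le[OF _ nn]) linarith
  show "sqrt (1 + m\<^sup>2) * sinh x < m * cosh x + sinh x" if "m > 0"
  proof (rule power2_less_imp_less[OF _ nn])
    have "m\<^sup>2 > 0" using that by simp
    then show "(sqrt (1 + m\<^sup>2) * sinh x)\<^sup>2 < (m * cosh x + sinh x)\<^sup>2"
      using eq ge by linarith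
  qed
qed

lemma log_norm_le_log_bound:
  assumes "m \<ge> 0" "p < q" "t \<ge> 0"
  shows "log_norm m p q t \<le> log_bound m p q t"
  using sqrt_mult_sinh_bound(1)[OF assms(1), of "(q - p) / 2 * t"] assms
  by (simp add: log_norm_def log_bound_def arsinh_le_iff_real)

lemma log_norm_less_log_bound:
  assumes "m > 0" "p < q" "t \<ge> 0"
  shows "log_norm m p q t < log_bound m p q t"
  using sqrt_mult_sinh_bound(2)[of m "(q - p) / 2 * t"] assms
  by (simp add: log_norm_def log_bound_def)

text \<open>A decreasing function meets the identity at most once; existence follows from the
  intermediate value theorem.\<close>

lemma log_bound_fixed_point:
  assumes "m \<ge> 0" "0 < p" "p < q" "\<alpha> > 0"
  shows "\<exists>!\<tau>. \<tau> \<ge> 0 \<and> log_bound m p q \<tau> / \<alpha> = \<tau>"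
proof (rule ex_ex1I)
  define h where "h t = log_bound m p q t / \<alpha> - t" for t
  have L0: "0 \<le> log_bound m p q 0"
    using assms by (simp add: log_bound_def flip: not_less)
  \<comment> \<open>\<open>T\<close> is the value S(0). As S decreases, S(T) \<le> S(0) = T, so
    \<open>h\<close> changes sign on [0, T].\<close>
  define T where "T = log_bound m p q 0 / \<alpha>"
  have T: "T \<ge> 0" using L0 assms by (simp add: T_def)
  have "log_bound m p q T \<le> log_bound m p q 0 - p * (T - 0)"
    by (rule log_bound_decrease) (use assms T in auto)
  also have "\<dots> \<le> log_bound m p q 0" using T assms by simp
  finally have "h T \<le> 0" using assms by (simp add: h_def T_def divide_right_mono)
  moreover have "0 \<le> h 0" using L0 assms by (simp add: h_def)
  moreover have "continuous_on {0..T} h"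
    unfolding h_def log_bound_def using assms by (intro continuous_intros) auto
  ultimately obtain \<tau> where "0 \<le> \<tau>" "h \<tau> = 0"
    using IVT2'[of h T 0 0] T by auto
  then show "\<exists>\<tau>. \<tau> \<ge> 0 \<and> log_bound m p q \<tau> / \<alpha> = \<tau>"
    by (auto simp: h_def)
next
  have less: "\<not> s < t" if st: "s \<ge> 0 \<and> log_bound m p q s / \<alpha> = s" "t \<ge> 0 \<and> log_bound m p q t / \<alpha> = t" for s t
  proof
    assume "s < t"
    then have "0 < p * (t - s)" "0 < \<alpha> * (t - s)" using assms by auto
    moreover have "log_bound m p q t \<le> log_bound m p q s - p * (t - s)"
      using \<open>s < t\<close> st assms by (intro log_bound_decrease) auto
    moreover have "log_bound m p q t = \<alpha> * t" "log_bound m p q s = \<alpha> * s"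
      using st assms by (auto simp: field_simps)
    ultimately show False by (simp add: algebra_simps)
  qed
  fix s t
  assume "s \<ge> 0 \<and> log_bound m p q s / \<alpha> = s" "t \<ge> 0 \<and> log_bound m p q t / \<alpha> = t"
  from less[OF this] less[OF this(2,1)] show "s = t" by simp
qed

text \<open>This supplies one contraction rate for all cycles. For \<open>t\<close> far beyond
  \<tau> the decrease of \<open>log_bound\<close> suffices; for \<open>t\<close> near \<tau> the
  strict gap between \<open>log_norm\<close> and \<open>log_bound\<close> has a positive minimum by
  compactness. The bound \<open>c \<le> \<alpha>\<close> lets the focus phase beyond \<tau> contract
  at rate \<open>c\<close> as well.\<close>

lemma log_norm_gap:
  assumes "m \<ge> 0" "0 < p" "p < q" "\<alpha> > 0" and \<tau>: "\<tau> \<ge> 0" "log_bound m p q \<tau> / \<alpha> = \<tau>"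
  obtains c where "c > 0" "c \<le> \<alpha>" "\<And>t. t \<ge> \<tau> \<Longrightarrow> log_norm m p q t \<le> \<alpha> * \<tau> - c * (t + \<tau>)"
proof -
  have fix': "log_bound m p q \<tau> = \<alpha> * \<tau>" using \<tau> assms by (auto simp: field_simps)
  have bd: "log_norm m p q t \<le> \<alpha> * \<tau> - p * (t - \<tau>)" if "t \<ge> \<tau>" for t
    using log_norm_le_log_bound[of m p q t] log_bound_decrease[of m p q \<tau> t] that assms fix' by simp
  \<comment> \<open>For \<open>t \<ge> 2 * \<tau>\<close> one has
    \<open>t + \<tau> \<le> 3 * (t - \<tau>)\<close>, whence the constant
    \<open>p / 3\<close>.\<close>
  have far: "log_norm m p q t \<le> \<alpha> * \<tau> - c * (t + \<tau>)" if "t \<ge> 2 * \<tau>" "0 \<le> c" "c \<le> p / 3" for t c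
  proof -
    have "c * (t + \<tau>) \<le> p / 3 * (t + \<tau>)" using that \<tau> by (intro mult_right_mono) auto
    also have "\<dots> \<le> p / 3 * (3 * (t - \<tau>))" using that assms by (intro mult_left_mono) auto
    also have "\<dots> = p * (t - \<tau>)" by simp
    finally show ?thesis using bd[of t] that \<tau> by linarith
  qed
  show thesis
  proof (cases "\<tau> = 0")
    case True
    \<comment> \<open>For \<tau> = 0 the far range \<open>t \<ge> 2 * \<tau>\<close> is already
      everything.\<close>
    show ?thesis
      by (rule that[of "min \<alpha> (p / 3)"]) (use assms True in \<open>auto intro!: far[unfolded True, simplified]\<close>)
  next
    case False
    \<comment> \<open>If \<open>m = 0\<close>, then \<open>log_bound\<close> starts at 0 and
      decreases, so it cannot take the positive value \<open>\<alpha> * \<tau>\<close>.\<close>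
    have "m > 0"
    proof (rule ccontr)
      assume "\<not> m > 0"
      then have "m = 0" using assms by simp
      then have "log_bound m p q 0 = 0" by (simp add: log_bound_def)
      then have "\<alpha> * \<tau> \<le> - p * \<tau>"
        using log_bound_decrease[of m p q 0 \<tau>] assms fix' by simp
      moreover have "0 < \<alpha> * \<tau>" "0 < p * \<tau>" using False \<tau> assms by auto
      ultimately show False by simp
    qed
    define g where "g t = log_bound m p q t - log_norm m p q t" for t
    have "continuous_on {\<tau>..2*\<tau>} g"
      unfolding g_def log_bound_def log_norm_def by (intro continuous_intros)
    then obtain t0 where t0: "t0 \<in> {\<tau>..2*\<tau>}" "\<And>t. t \<in> {\<tau>..2*\<tau>} \<Longrightarrow> g t0 \<le> g t"
      using continuous_attains_inf[of "{\<tau>..2*\<tau>}" g] \<tau> by (auto simp: Bex_def)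
    have g0: "g t0 > 0"
      using log_norm_less_log_bound[OF \<open>m > 0\<close>, of p q t0] t0(1) \<tau> assms by (simp add: g_def)
    \<comment> \<open>The last entry serves the near range, where
      \<open>t + \<tau> \<le> 3 * \<tau>\<close>, so that \<open>c * (t + \<tau>)\<close> stays
      below the minimal gap \<open>g t0\<close>.\<close>
    define c where "c = min (min \<alpha> (p / 3)) (g t0 / (3 * \<tau>))"
    have c: "c > 0" "c \<le> \<alpha>" "c \<le> p / 3" "c \<le> g t0 / (3 * \<tau>)"
      using False \<tau> assms g0 by (auto simp: c_def)
    then have c3: "c * (3 * \<tau>) \<le> g t0" using False \<tau> by (simp add: field_simps)
    show ?thesis
    proof (rule that[OF c(1,2)])
      fix t assume t: "t \<ge> \<tau>"
      show "log_norm m p q t \<le> \<alpha> * \<tau> - c * (t + \<tau>)"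
      proof (cases "t \<le> 2 * \<tau>")
        case True
        have "c * (t + \<tau>) \<le> c * (3 * \<tau>)" using True c by (intro mult_left_mono) auto
        also have "\<dots> \<le> g t" using c3 t0(2)[of t] t True by simp
        finally have "log_norm m p q t \<le> log_bound m p q t - c * (t + \<tau>)" by (simp add: g_def)
        moreover have "0 \<le> p * (t - \<tau>)" using t assms by simp
        then have "log_bound m p q t \<le> \<alpha> * \<tau>"
          using log_bound_decrease[of m p q \<tau> t] t \<tau> assms fix' by linarith
        ultimately show ?thesis by simp
      qed (use far[of t c] c in simp)
    qed
  qed
qed

section \<open>Trajectories within a single node or focus phase\<close>

lemma matrix_inv_inverse:
  fixes P :: "real^'n^'n"
  assumes "invertible P"
  shows "P ** matrix_inv P = mat 1" and "matrix_inv P ** P = mat 1"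
proof -
  have "P ** matrix_inv P = mat 1 \<and> matrix_inv P ** P = mat 1"
    unfolding matrix_inv_def using assms unfolding invertible_def by (rule someI_ex)
  then show "P ** matrix_inv P = mat 1" "matrix_inv P ** P = mat 1" by auto
qed

text \<open>The product with the integrating factor has derivative 0. Differentiability is assumed
  only in the open interval because the endpoints will be switching times.\<close>

lemma exponential_solution:
  fixes f :: "real \<Rightarrow> real"
  assumes cont: "continuous_on {u..v} f"
    and deriv: "\<And>t. u < t \<Longrightarrow> t < v \<Longrightarrow> (f has_real_derivative l * f t) (at t)"
    and t: "u \<le> t" "t \<le> v"
  shows "f t = exp (l * (t - u)) * f u"
proof (cases "u = v")
  case False
  then have uv: "u < v" using t by simp
  define g where "g s = exp (- l * (s - u)) * f s" for s
  have "continuous_on {u..v} g"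
    unfolding g_def by (intro continuous_intros cont)
  moreover have "(g has_real_derivative 0) (at s)" if "u < s" "s < v" for s
    unfolding g_def by (rule derivative_eq_intros deriv that refl | simp)+
  ultimately have "g t = g u"
    using DERIV_isconst2[of u v g t] uv t by blast
  then have "exp (l * (t - u)) * (exp (- l * (t - u)) * f t) = exp (l * (t - u)) * f u"
    by (simp add: g_def)
  then show ?thesis by (simp flip: exp_add mult.assoc)
qed (use t in auto)

lemma norm_vec2_sq: "(norm (x :: real^2))\<^sup>2 = (x $ 1)\<^sup>2 + (x $ 2)\<^sup>2"
  by (simp add: norm_vec_def L2_set_def sum_2)

lemma mat2_mult_nth [simp]:
  "(mat2 a b c d *v x) $ 1 = a * x $ 1 + b * x $ 2"
  "(mat2 a b c d *v x) $ 2 = c * x $ 1 + d * x $ 2"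
  by (simp_all add: mat2_def matrix_vector_mult_def sum_2)

lemma has_vector_derivative_nth:
  fixes x :: "real \<Rightarrow> real^'n"
  assumes "(x has_vector_derivative D) F"
  shows "((\<lambda>t. x t $ i) has_vector_derivative D $ i) F"
  using bounded_linear.has_vector_derivative[OF bounded_linear_vec_nth assms] by simp

text \<open>Here \<open>z\<close> stands for the eigen-coordinates of the node, and
  \<open>mat2 a b c d\<close> carries them to the coordinates of the focus. Splitting the mean decay
  \<open>r\<close> off both exponentials leaves the flow treated in
  \<open>node_flow_bound\<close>.\<close>

lemma node_phase:
  fixes z :: "real \<Rightarrow> real^2"
  assumes cont: "continuous_on {u..v} z"
    and deriv: "\<And>t. u < t \<Longrightarrow> t < v \<Longrightarrow> (z has_vector_derivative mat2 (- p) 0 0 (- q) *v z t) (at t)"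
    and det: "a * d - b * c = 1" and pq: "p < q" and t: "u \<le> t" "t \<le> v"
  shows "norm (mat2 a b c d *v z t) \<le> exp (log_norm \<bar>a * b + c * d\<bar> p q (t - u)) * norm (mat2 a b c d *v z u)"
proof -
  define h where "h = t - u"
  define x where "x = (q - p) / 2 * h"
  define r where "r = exp (- ((q + p) / 2) * h)"
  define g where "g = arsinh (sqrt (1 + (a * b + c * d)\<^sup>2) * sinh x)"
  have x: "x \<ge> 0" using pq t by (simp add: x_def h_def)
  have D: "((\<lambda>s. z s $ i) has_real_derivative (mat2 (- p) 0 0 (- q) *v z s) $ i) (at s)"
    if "u < s" "s < v" for s i
    using has_vector_derivative_nth[OF deriv[OF that]] by (simp add: has_real_derivative_iff_has_vector_derivative)
  have C: "continuous_on {u..v} (\<lambda>s. z s $ i)" for i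
    by (intro continuous_intros cont)
  have z1: "z t $ 1 = exp (- p * h) * z u $ 1"
    unfolding h_def by (rule exponential_solution[OF C _ t]) (use D[of _ 1] in simp)
  have z2: "z t $ 2 = exp (- q * h) * z u $ 2"
    unfolding h_def by (rule exponential_solution[OF C _ t]) (use D[of _ 2] in simp)
  have e1: "exp (- p * h) = r * exp x" and e2: "exp (- q * h) = r * exp (- x)"
    by (auto simp: r_def x_def field_simps simp flip: exp_add)
  have "(norm (mat2 a b c d *v z t))\<^sup>2 =
      r\<^sup>2 * ((a * exp x * z u $ 1 + b * exp (- x) * z u $ 2)\<^sup>2 + (c * exp x * z u $ 1 + d * exp (- x) * z u $ 2)\<^sup>2)"
    unfolding norm_vec2_sq mat2_mult_nth z1 z2 e1 e2 by (simp add: power2_eq_square algebra_simps)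
  also have "\<dots> \<le> r\<^sup>2 * ((exp g)\<^sup>2 * (norm (mat2 a b c d *v z u))\<^sup>2)"
    unfolding norm_vec2_sq mat2_mult_nth g_def by (intro mult_left_mono node_flow_bound det x) simp
  also have "\<dots> = (r * exp g * norm (mat2 a b c d *v z u))\<^sup>2"
    by (simp add: power_mult_distrib)
  finally have "norm (mat2 a b c d *v z t) \<le> r * exp g * norm (mat2 a b c d *v z u)"
    by (rule power2_le_imp_le) (simp add: r_def)
  also have "r * exp g = exp (log_norm \<bar>a * b + c * d\<bar> p q (t - u))"
    by (simp add: r_def g_def x_def h_def log_norm_def flip: exp_add)
  finally show ?thesis .
qed

text \<open>The terms with \<beta> cancel in the derivative of the squared norm, which therefore
  solves a scalar equation with rate \<open>- 2 * \<alpha>\<close>.\<close>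

lemma focus_phase:
  fixes y :: "real \<Rightarrow> real^2"
  assumes cont: "continuous_on {u..v} y"
    and deriv: "\<And>t. u < t \<Longrightarrow> t < v \<Longrightarrow> (y has_vector_derivative mat2 (- \<alpha>) \<beta> (- \<beta>) (- \<alpha>) *v y t) (at t)"
    and t: "u \<le> t" "t \<le> v"
  shows "norm (y t) = exp (- \<alpha> * (t - u)) * norm (y u)"
proof -
  define f where "f s = (y s $ 1)\<^sup>2 + (y s $ 2)\<^sup>2" for s
  have D: "((\<lambda>s. y s $ i) has_real_derivative (mat2 (- \<alpha>) \<beta> (- \<beta>) (- \<alpha>) *v y s) $ i) (at s)"
    if "u < s" "s < v" for s i
    using has_vector_derivative_nth[OF deriv[OF that]] by (simp add: has_real_derivative_iff_has_vector_derivative)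
  have "continuous_on {u..v} f"
    unfolding f_def by (intro continuous_intros cont)
  moreover have "(f has_real_derivative (- 2 * \<alpha>) * f s) (at s)" if "u < s" "s < v" for s
    unfolding f_def
    by (rule derivative_eq_intros D[OF that] refl)+ (simp add: power2_eq_square algebra_simps)
  ultimately have "f t = exp ((- 2 * \<alpha>) * (t - u)) * f u"
    by (rule exponential_solution) (use t in auto)
  also have "exp ((- 2 * \<alpha>) * (t - u)) = (exp (- \<alpha> * (t - u)))\<^sup>2"
    by (simp add: power2_eq_square flip: exp_add)
  finally have "(norm (y t))\<^sup>2 = (exp (- \<alpha> * (t - u)) * norm (y u))\<^sup>2"
    by (simp add: f_def power_mult_distrib norm_vec2_sq)
  then show ?thesis
    by (simp add: power2_eq_iff_nonneg)
qed

section \<open>Alternation of the subsystems along a signal\<close>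

lemma signal_alternates:
  assumes \<sigma>: "signal \<sigma>" and d: "switching_times \<sigma> d" and t: "d k < t" "t < d (Suc k)"
  shows "\<sigma> t = (if even k then 1 else 2)"
proof -
  have mono: "strict_mono d" and d0: "d 0 = 0" and disc: "discontinuities \<sigma> = d ` {1..}"
    and const: "\<And>k. \<sigma> constant_on {d k<..<d (Suc k)}"
    using d by (auto simp: switching_times_def)
  have nonneg: "d k \<ge> 0" for k
    using strict_mono_less_eq[OF mono, of 0 k] d0 by simp
  have less: "d k < d (Suc k)" for k using strict_monoD[OF mono] by simp
  \<comment> \<open>Right-continuity carries the constant value of the open interval to its left
    endpoint: in a discrete space, convergence is eventual equality.\<close>
  have left: "\<sigma> s = \<sigma> (d k)" if s: "d k \<le> s" "s < d (Suc k)" for k s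
  proof (cases "s = d k")
    case False
    obtain c where c: "\<And>s. s \<in> {d k<..<d (Suc k)} \<Longrightarrow> \<sigma> s = c"
      using const[of k] by (auto simp: constant_on_def)
    have "(\<sigma> \<longlongrightarrow> \<sigma> (d k)) (at_right (d k))"
      using \<sigma> nonneg[of k] by (auto simp: signal_def continuous_within)
    then have "\<forall>\<^sub>F s in at_right (d k). \<sigma> s = \<sigma> (d k)"
      by (rule tendsto_discrete[THEN iffD1, rotated])
    moreover have "\<forall>\<^sub>F s in at_right (d k). s \<in> {d k<..<d (Suc k)}"
      by (rule eventually_at_right_real[OF less])
    ultimately have "\<forall>\<^sub>F s in at_right (d k). \<sigma> (d k) = c"
      by eventually_elim (use c in auto)
    then have "\<sigma> (d k) = c" by simp
    then show ?thesis using c[of s] s False by simp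
  qed simp
  \<comment> \<open>Equal values on both sides would make \<sigma> locally constant at a
    discontinuity. With only two values available, a jump at each switching time forces
    alternation.\<close>
  have jump: "\<sigma> (d (Suc k)) \<noteq> \<sigma> (d k)" for k
  proof
    assume eq: "\<sigma> (d (Suc k)) = \<sigma> (d k)"
    have "\<sigma> s = \<sigma> (d k)" if "s \<in> {d k<..<d (Suc (Suc k))}" for s
      using left[of k s] left[of "Suc k" s] that eq by (cases "s < d (Suc k)") auto
    then have "\<forall>\<^sub>F s in nhds (d (Suc k)). \<sigma> s = \<sigma> (d k)"
      using less[of k] less[of "Suc k"]
      by (intro eventually_nhds[THEN iffD2] exI[of _ "{d k<..<d (Suc (Suc k))}"]) auto
    then have "isCont \<sigma> (d (Suc k))"
      by (subst isCont_cong[where g = "\<lambda>_. \<sigma> (d k)"]) auto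
    moreover have "d (Suc k) \<in> discontinuities \<sigma>" by (simp add: disc)
    ultimately show False by (simp add: discontinuities_def)
  qed
  have "\<sigma> (d k) = (if even k then 1 else 2)" for k
  proof (induction k)
    case 0
    then show ?case using \<sigma> by (simp add: signal_def d0)
  next
    case (Suc k)
    have "\<sigma> (d (Suc k)) \<in> {1, 2}" using \<sigma> nonneg by (simp add: signal_def)
    with jump[of k] Suc show ?case by (auto split: if_splits)
  qed
  then show ?thesis using left[of k t] t by simp
qed

lemma switched_solution_deriv:
  assumes x: "switched_solution A \<sigma> x" and \<sigma>: "signal \<sigma>" and d: "switching_times \<sigma> d"
    and t: "d k < t" "t < d (Suc k)"
  shows "(x has_vector_derivative A (if even k then 1 else 2) *v x t) (at t)"
proof -
  have mono: "strict_mono d" and d0: "d 0 = 0" and disc: "discontinuities \<sigma> = d ` {1..}"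
    using d by (auto simp: switching_times_def)
  have "d k \<ge> 0" using strict_mono_less_eq[OF mono, of 0 k] d0 by simp
  then have t0: "t > 0" using t by simp
  have "t \<notin> discontinuities \<sigma>"
  proof
    assume "t \<in> discontinuities \<sigma>"
    then obtain j where "t = d j" by (auto simp: disc)
    with t have "k < j" "j < Suc k" using strict_mono_less[OF mono] by auto
    then show False by simp
  qed
  then have "(x has_vector_derivative A (\<sigma> t) *v x t) (at t within {0..})"
    using x t0 by (simp add: switched_solution_def)
  moreover have "at t within {0..} = at t"
    using t0 by (intro at_within_interior) simp
  ultimately show ?thesis using signal_alternates[OF \<sigma> d t] by simp
qed

section \<open>From exponential decay to asymptotic stability\<close>

lemma strict_mono_locate:
  fixes e :: "nat \<Rightarrow> real"
  assumes lim: "filterlim e at_top sequentially" and "e j0 \<le> t" and mono: "strict_mono e"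
  obtains j where "j \<ge> j0" "e j \<le> t" "t < e (Suc j)"
proof -
  have "\<exists>n. t < e n"
    using lim by (metis eventually_sequentially filterlim_at_top_dense order_refl)
  define n where "n = (LEAST n. t < e n)"
  have n: "t < e n" unfolding n_def using \<open>\<exists>n. t < e n\<close> by (rule LeastI_ex)
  have below: "e i \<le> t" if "i < n" for i
    using not_less_Least[of i "\<lambda>n. t < e n"] that by (simp add: n_def)
  have "j0 < n" using \<open>e j0 \<le> t\<close> n strict_mono_less[OF mono, of j0 n] by linarith
  then show ?thesis
    using that[of "n - 1"] n below[of "n - 1"] by auto
qed

text \<open>The times \<open>e j\<close> separate the cycles, and \<open>K\<close> absorbs transient
  growth inside a cycle. Passing between \<open>x\<close> and \<open>P *v x\<close> costs only
  constant factors. Stability is the case \<open>j = 0\<close> of the resulting bound, attraction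
  its limit in \<open>j\<close>.\<close>

lemma asymptotically_stable_if_decay:
  fixes A :: "nat \<Rightarrow> real^2^2" and P Q :: "real^2^2"
  assumes inv: "Q ** P = mat 1" and c: "c > 0"
    and e: "strict_mono e" "e 0 = 0" "filterlim e at_top sequentially"
    and decay: "\<And>x j t. switched_solution A \<sigma> x \<Longrightarrow> e j \<le> t \<Longrightarrow> t \<le> e (Suc j) \<Longrightarrow>
                  norm (P *v x t) \<le> K * exp (- c * e j) * norm (P *v x 0)"
  shows "switched_asymptotically_stable A \<sigma>"
proof -
  obtain C1 where C1: "C1 > 0" "\<And>x. norm (P *v x) \<le> norm x * C1"
    using bounded_linear.pos_bounded[OF matrix_vector_mul_bounded_linear[of P]] by blast
  obtain C2 where C2: "C2 > 0" "\<And>x. norm (Q *v x) \<le> norm x * C2"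
    using bounded_linear.pos_bounded[OF matrix_vector_mul_bounded_linear[of Q]] by blast
  \<comment> \<open>The summand 1 keeps \<open>C\<close> positive even for \<open>K = 0\<close>, so
    that \<open>\<epsilon> / C\<close> can serve as \<delta>.\<close>
  define C where "C = C2 * \<bar>K\<bar> * C1 + 1"
  have C: "C > 0" unfolding C_def using C1 C2 by (intro add_nonneg_pos mult_nonneg_nonneg) auto
  have bound: "norm (x t) \<le> C * exp (- c * e j) * norm (x 0)"
    if x: "switched_solution A \<sigma> x" and t: "e j \<le> t" "t \<le> e (Suc j)" for x j t
  proof -
    have "x t = Q *v (P *v x t)" by (simp add: matrix_vector_mul_assoc inv)
    then have "norm (x t) \<le> norm (P *v x t) * C2" using C2(2)[of "P *v x t"] by simp
    also have "\<dots> \<le> (K * exp (- c * e j) * norm (P *v x 0)) * C2"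
      using decay[OF x t] C2(1) by (intro mult_right_mono) auto
    also have "\<dots> \<le> (\<bar>K\<bar> * exp (- c * e j) * (norm (x 0) * C1)) * C2"
      using C1 C2 by (intro mult_right_mono mult_mono) auto
    also have "\<dots> = (C - 1) * (exp (- c * e j) * norm (x 0))"
      by (simp add: C_def)
    also have "\<dots> \<le> C * (exp (- c * e j) * norm (x 0))"
      by (intro mult_right_mono) auto
    finally show ?thesis by simp
  qed
  have tail: "norm (x t) \<le> C * exp (- c * e j) * norm (x 0)"
    if x: "switched_solution A \<sigma> x" and t: "e j \<le> t" for x j t
  proof -
    obtain i where i: "i \<ge> j" "e i \<le> t" "t < e (Suc i)"
      using strict_mono_locate[OF e(3) t e(1)] .
    have "norm (x t) \<le> C * exp (- c * e i) * norm (x 0)"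
      using bound[OF x i(2)] i(3) by simp
    also have "\<dots> \<le> C * exp (- c * e j) * norm (x 0)"
      using C c strict_mono_less_eq[OF e(1), of j i] i(1)
      by (intro mult_right_mono mult_left_mono) auto
    finally show ?thesis .
  qed
  have "switched_stable A \<sigma>"
    unfolding switched_stable_def
  proof (intro allI impI)
    fix \<epsilon> :: real assume \<epsilon>: "\<epsilon> > 0"
    show "\<exists>\<delta>>0. \<forall>x. switched_solution A \<sigma> x \<longrightarrow> norm (x 0) < \<delta> \<longrightarrow> (\<forall>t>0. norm (x t) < \<epsilon>)"
    proof (intro exI[of _ "\<epsilon> / C"] conjI allI impI)
      fix x :: "real \<Rightarrow> real^2" and t :: real
      assume "switched_solution A \<sigma> x" "norm (x 0) < \<epsilon> / C" "t > 0"
      then have "norm (x t) \<le> C * norm (x 0)" "C * norm (x 0) < \<epsilon>"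
        using tail[of x 0 t] e(2) C by (auto simp: field_simps)
      then show "norm (x t) < \<epsilon>" by simp
    qed (use \<epsilon> C in simp)
  qed
  moreover have "((\<lambda>t. norm (x t)) \<longlongrightarrow> 0) at_top" if x: "switched_solution A \<sigma> x" for x
  proof (rule tendstoI)
    fix \<epsilon> :: real assume \<epsilon>: "\<epsilon> > 0"
    have "filterlim (\<lambda>j. - c * e j) at_bot sequentially"
      using filterlim_tendsto_pos_mult_at_top[OF tendsto_const c e(3)]
      by (simp add: filterlim_uminus_at_bot)
    then have "(\<lambda>j. exp (- c * e j)) \<longlonglongrightarrow> 0"
      by (rule filterlim_compose[OF exp_at_bot])
    then have "(\<lambda>j. C * exp (- c * e j) * norm (x 0)) \<longlonglongrightarrow> C * 0 * norm (x 0)"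
      by (intro tendsto_intros)
    then have "\<forall>\<^sub>F j in sequentially. C * exp (- c * e j) * norm (x 0) < \<epsilon>"
      using \<epsilon> by (intro order_tendstoD(2)) auto
    then obtain j where j: "C * exp (- c * e j) * norm (x 0) < \<epsilon>"
      by (auto simp: eventually_sequentially)
    show "\<forall>\<^sub>F t in at_top. dist (norm (x t)) 0 < \<epsilon>"
      using eventually_ge_at_top[of "e j"]
      by eventually_elim (use order_le_less_trans[OF tail[OF x] j] in simp)
  qed
  ultimately show ?thesis by (simp add: switched_asymptotically_stable_def)
qed

section \<open>Contraction over a full cycle\<close>

lemma strict_mono_double: "strict_mono (d :: nat \<Rightarrow> real) \<Longrightarrow> strict_mono (\<lambda>j. d (2 * j))"
  by (simp add: strict_mono_def)

text \<open>A cycle is a node phase from \<open>D (2 * j)\<close> to \<open>D (2 * j + 1)\<close>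
  and a focus phase up to \<open>D (2 * j + 2)\<close>. Each cycle shrinks the norm of
  \<open>y\<close> by the exponential of \<open>- \<gamma>\<close> times its length, and these
  factors telescope.\<close>

lemma dwell_imp_asymptotically_stable:
  fixes A :: "nat \<Rightarrow> real^2^2" and P1 P2 :: "real^2^2"
  assumes inv: "invertible P1" "invertible P2"
    and A1: "A 1 = P1 ** mat2 (- p) 0 0 (- q) ** matrix_inv P1"
    and A2: "A 2 = P2 ** mat2 (- \<alpha>) \<beta> (- \<beta>) (- \<alpha>) ** matrix_inv P2"
    and pq: "0 < p" "p < q" and \<alpha>: "\<alpha> > 0"
    and M: "matrix_inv P2 ** P1 = mat2 a b c d" and det: "a * d - b * c = 1"
    and \<tau>: "\<tau> \<ge> 0" "log_bound m p q \<tau> / \<alpha> = \<tau>" and m: "m = \<bar>a * b + c * d\<bar>"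
    and \<sigma>: "signal \<sigma>" and D: "switching_times \<sigma> D"
    and dwell: "\<And>j. j \<ge> 1 \<Longrightarrow> dwell_1 D j \<ge> \<tau> \<and> dwell_2 D j \<ge> \<tau>"
  shows "switched_asymptotically_stable A \<sigma>"
proof -
  have mono: "strict_mono D" and D0: "D 0 = 0" and lim: "filterlim D at_top sequentially"
    using D by (auto simp: switching_times_def)
  have Dle: "D i \<le> D j" if "i \<le> j" for i j using strict_mono_less_eq[OF mono] that by simp
  have D_nonneg: "D j \<ge> 0" for j using Dle[of 0 j] D0 by simp
  have m0: "m \<ge> 0" by (simp add: m)
  obtain \<gamma> where \<gamma>: "\<gamma> > 0" "\<gamma> \<le> \<alpha>" "\<And>t. t \<ge> \<tau> \<Longrightarrow> log_norm m p q t \<le> \<alpha> * \<tau> - \<gamma> * (t + \<tau>)"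
    using log_norm_gap[OF m0 pq \<alpha> \<tau>] by blast
  \<comment> \<open>Since \<open>log_bound\<close> decreases and dominates \<open>log_norm\<close>,
    its value at 0 bounds the overshoot of every node phase.\<close>
  define K where "K = exp (log_bound m p q 0)"
  have log_le_K: "exp (log_norm m p q t) \<le> K" if "t \<ge> 0" for t
  proof -
    have "0 \<le> p * t" using that pq by simp
    then show ?thesis
      unfolding K_def exp_le_cancel_iff
      using log_norm_le_log_bound[OF m0 pq(2) that] log_bound_decrease[OF m0 pq(2) order_refl that] by simp
  qed
  have K: "K > 0" by (simp add: K_def)
  show ?thesis
  proof (rule asymptotically_stable_if_decay[where P = "matrix_inv P2" and Q = P2 and c = \<gamma> and K = K
        and e = "\<lambda>j. D (2 * j)"])
    show "filterlim (\<lambda>j. D (2 * j)) at_top sequentially"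
      by (rule filterlim_compose[OF lim]) (auto intro!: filterlim_subseq simp: strict_mono_def)
    fix x assume x: "switched_solution A \<sigma> x"
    define y z where "y t = matrix_inv P2 *v x t" and "z t = matrix_inv P1 *v x t" for t
    have yz: "y t = mat2 a b c d *v z t" for t
    proof -
      have "mat2 a b c d *v z t = matrix_inv P2 *v ((P1 ** matrix_inv P1) *v x t)"
        by (simp add: z_def flip: M matrix_vector_mul_assoc)
      then show ?thesis by (simp add: y_def matrix_inv_inverse inv)
    qed
    have cont: "continuous_on {D i..D j} x" for i j
    proof (rule continuous_on_subset)
      show "continuous_on {0..} x" using x by (simp add: switched_solution_def)
      show "{D i..D j} \<subseteq> {0..}" using D_nonneg[of i] by auto
    qed
    have cont_yz: "continuous_on {D i..D j} y" "continuous_on {D i..D j} z" for i j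
      unfolding y_def z_def
      by (auto intro!: bounded_linear.continuous_on[OF matrix_vector_mul_bounded_linear] cont)
    have phase1: "norm (y t) \<le> exp (log_norm m p q (t - D (2 * j))) * norm (y (D (2 * j)))"
      if t: "D (2 * j) \<le> t" "t \<le> D (Suc (2 * j))" for j t
      unfolding yz m
    proof (rule node_phase[OF cont_yz(2) _ det pq(2) t])
      fix s assume s: "D (2 * j) < s" "s < D (Suc (2 * j))"
      have "(x has_vector_derivative A 1 *v x s) (at s)"
        using switched_solution_deriv[OF x \<sigma> D s] by simp
      then have "(z has_vector_derivative matrix_inv P1 *v (A 1 *v x s)) (at s)"
        unfolding z_def by (rule bounded_linear.has_vector_derivative[OF matrix_vector_mul_bounded_linear])
      also have "matrix_inv P1 *v (A 1 *v x s) = mat2 (- p) 0 0 (- q) *v z s"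
        unfolding A1 z_def by (simp add: matrix_vector_mul_assoc matrix_mul_assoc matrix_inv_inverse inv)
      finally show "(z has_vector_derivative mat2 (- p) 0 0 (- q) *v z s) (at s)" .
    qed
    have phase2: "norm (y t) = exp (- \<alpha> * (t - D (Suc (2 * j)))) * norm (y (D (Suc (2 * j))))"
      if t: "D (Suc (2 * j)) \<le> t" "t \<le> D (Suc (Suc (2 * j)))" for j t
    proof (rule focus_phase[OF cont_yz(1) _ t])
      fix s assume s: "D (Suc (2 * j)) < s" "s < D (Suc (Suc (2 * j)))"
      have "(x has_vector_derivative A 2 *v x s) (at s)"
        using switched_solution_deriv[OF x \<sigma> D s] by simp
      then have "(y has_vector_derivative matrix_inv P2 *v (A 2 *v x s)) (at s)"
        unfolding y_def by (rule bounded_linear.has_vector_derivative[OF matrix_vector_mul_bounded_linear])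
      also have "matrix_inv P2 *v (A 2 *v x s) = mat2 (- \<alpha>) \<beta> (- \<beta>) (- \<alpha>) *v y s"
        unfolding A2 y_def by (simp add: matrix_vector_mul_assoc matrix_mul_assoc matrix_inv_inverse inv)
      finally show "(y has_vector_derivative mat2 (- \<alpha>) \<beta> (- \<beta>) (- \<alpha>) *v y s) (at s)" .
    qed
    have cycle: "norm (y (D (2 * Suc j))) \<le> exp (- \<gamma> * (D (2 * Suc j) - D (2 * j))) * norm (y (D (2 * j)))" for j
    proof -
      define h k where "h = D (Suc (2 * j)) - D (2 * j)" and "k = D (Suc (Suc (2 * j))) - D (Suc (2 * j))"
      \<comment> \<open>Cycles are counted from 0 but dwell times from 1, hence the index
        \<open>Suc j\<close>.\<close>
      have hk: "h \<ge> \<tau>" "k \<ge> \<tau>"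
        using dwell[of "Suc j"] by (auto simp: dwell_1_def dwell_2_def h_def k_def)
      have "norm (y (D (2 * Suc j))) = exp (- \<alpha> * k) * norm (y (D (Suc (2 * j))))"
        using phase2[where j = j and t = "D (Suc (Suc (2 * j)))"] Dle by (simp add: k_def)
      also have "\<dots> \<le> exp (- \<alpha> * k) * (exp (log_norm m p q h) * norm (y (D (2 * j))))"
        using phase1[where j = j and t = "D (Suc (2 * j))"] Dle
        by (intro mult_left_mono) (auto simp: h_def)
      also have "\<dots> = exp (log_norm m p q h - \<alpha> * k) * norm (y (D (2 * j)))"
        by (simp add: exp_diff exp_minus field_simps)
      also have "\<dots> \<le> exp (- \<gamma> * (h + k)) * norm (y (D (2 * j)))"
      proof -
        \<comment> \<open>The first \<tau> units of the focus phase pay for the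
          \<open>\<alpha> * \<tau>\<close> in \<open>log_norm_gap\<close>; the remaining
          \<open>k - \<tau>\<close> damp at rate \<open>\<alpha> \<ge> \<gamma>\<close>.\<close>
        have "0 \<le> (\<alpha> - \<gamma>) * (k - \<tau>)" using \<gamma>(2) hk by simp
        then have "log_norm m p q h - \<alpha> * k \<le> - \<gamma> * (h + k)"
          using \<gamma>(3)[OF hk(1)] by (simp add: algebra_simps)
        then show ?thesis by (intro mult_right_mono) auto
      qed
      finally show ?thesis by (simp add: h_def k_def)
    qed
    have ends: "norm (y (D (2 * j))) \<le> exp (- \<gamma> * D (2 * j)) * norm (y 0)" for j
    proof (induction j)
      case 0
      show ?case by (simp add: D0)
    next
      case (Suc j)
      have "norm (y (D (2 * Suc j))) \<le>
          exp (- \<gamma> * (D (2 * Suc j) - D (2 * j))) * (exp (- \<gamma> * D (2 * j)) * norm (y 0))"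
        by (rule order_trans[OF cycle mult_left_mono[OF Suc.IH]]) simp
      also have "\<dots> = exp (- \<gamma> * D (2 * Suc j)) * norm (y 0)"
        by (simp add: algebra_simps flip: exp_add mult.assoc)
      finally show ?case .
    qed
    have half: "norm (y t) \<le> K * norm (y (D (2 * j)))" if t: "D (2 * j) \<le> t" "t \<le> D (Suc (2 * j))" for j t
      using phase1[OF t] mult_right_mono[OF log_le_K[of "t - D (2 * j)"] norm_ge_zero[of "y (D (2 * j))"]] t
      by simp
    fix j t assume t: "D (2 * j) \<le> t" "t \<le> D (2 * Suc j)"
    \<comment> \<open>The norm of \<open>y\<close> does not grow in the focus phase, so the bound
      for the node phase covers the whole cycle.\<close>
    have "norm (y t) \<le> K * norm (y (D (2 * j)))"
    proof (cases "t \<le> D (Suc (2 * j))")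
      case False
      then have "norm (y t) \<le> 1 * norm (y (D (Suc (2 * j))))"
        using phase2[of j t] t \<alpha> by (simp add: mult_left_le_one_le)
      then show ?thesis using half[of j "D (Suc (2 * j))"] Dle by simp
    qed (use half t in simp)
    also have "\<dots> \<le> K * (exp (- \<gamma> * D (2 * j)) * norm (y 0))"
      using ends[of j] K by simp
    finally show "norm (matrix_inv P2 *v x t) \<le> K * exp (- \<gamma> * D (2 * j)) * norm (matrix_inv P2 *v x 0)"
      by (simp add: y_def mult.assoc)
  qed (use inv \<gamma> D0 mono in \<open>auto simp: matrix_inv_inverse strict_mono_double\<close>)
qed

theorem theorem5p1:
  fixes A :: "nat \<Rightarrow> real^2^2" and P1 P2 J1 J2 M :: "real^2^2"
    and p1 q1 \<alpha>2 \<beta>2 a b c d :: real and S :: "real \<Rightarrow> real"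
  assumes "invertible P1" and "invertible P2"
    and "A 1 = P1 ** J1 ** matrix_inv P1"
    and "A 2 = P2 ** J2 ** matrix_inv P2"
    and "J1 = mat2 (- p1) 0 0 (- q1)" and "0 < p1" and "p1 < q1"
    and "J2 = mat2 (- \<alpha>2) \<beta>2 (- \<beta>2) (- \<alpha>2)" and "\<alpha>2 > 0" and "\<beta>2 \<noteq> 0"
    and "M = matrix_inv P2 ** P1" and "M = mat2 a b c d" and "det M = 1"
    and "\<And>t. S t = - ((q1 + p1) / (2 * \<alpha>2)) * t
            + 1 / \<alpha>2 * arsinh (\<bar>a * b + c * d\<bar> * cosh ((q1 - p1) / 2 * t) + sinh ((q1 - p1) / 2 * t))"
  shows "(\<exists>!\<tau>. \<tau> \<ge> 0 \<and> S \<tau> = \<tau>) \<and>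
    (\<forall>\<tau>. \<tau> \<ge> 0 \<and> S \<tau> = \<tau> \<longrightarrow>
       (\<forall>\<sigma> \<in> dwell_signals \<tau>. switched_asymptotically_stable A \<sigma>))"
proof -
  define m where "m = \<bar>a * b + c * d\<bar>"
  have S: "S t = log_bound m p1 q1 t / \<alpha>2" for t
    using assms(9) by (simp add: assms(14) log_bound_def m_def field_simps)
  have det: "a * d - b * c = 1"
    using assms(12,13) by (simp add: det_2 mat2_def)
  have "\<exists>!\<tau>. \<tau> \<ge> 0 \<and> S \<tau> = \<tau>"
    unfolding S by (rule log_bound_fixed_point) (use assms in \<open>auto simp: m_def\<close>)
  moreover have "switched_asymptotically_stable A \<sigma>"
    if "\<tau> \<ge> 0" "S \<tau> = \<tau>" "\<sigma> \<in> dwell_signals \<tau>" for \<tau> \<sigma>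
  proof -
    obtain D where "signal \<sigma>" "switching_times \<sigma> D" "\<forall>j\<ge>1. dwell_1 D j \<ge> \<tau> \<and> dwell_2 D j \<ge> \<tau>"
      using \<open>\<sigma> \<in> dwell_signals \<tau>\<close> by (auto simp: dwell_signals_def)
    then show ?thesis
      using that(1) that(2)[unfolded S] assms(1-13) det m_def
      by (intro dwell_imp_asymptotically_stable[where ?P1.0 = P1 and ?P2.0 = P2 and p = p1 and q = q1 and \<alpha> = \<alpha>2 and \<beta> = \<beta>2
            and a = a and b = b and c = c and d = d and \<tau> = \<tau> and m = m and D = D]) auto
  qed
  ultimately show ?thesis by blast
qed

end
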